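(* Let $L_1$ and $L_2$ be two topologically trivial (oriented) Legendrian knots in $(\mathbb{R}^3,\xi_{std})$. If there exist an odd prime $p$ and a positive integer $k$ such that $p^k\mid s_{min}(L_1)$ and $p^k\nmid s_{min}(L_2)$, then $\mathcal{LR}(L_1)\neq\mathcal{LR}(L_2)$; that is, there is some $n\in\mathbb{N}$ for which the racks $LR_n(L_1)$ and $LR_n(L_2)$ are not isomorphic.
   Context: Racks. $\mathbb{N}=\{0,1,2,\dots\}$. A rack is a set $R$ with two binary operations $*$ and $/$ such that for all $x,y,z\in R$: $(x*y)*z=(x*z)*(y*z)$, $(x/y)/z=(x/z)/(y/z)$, $(x*y)/y=x$, $(x/y)*y=x$. Powers: $x^1=x$, $x^m=x^{m-1}*x$ for $m>1$. For $n\in\mathbb{N}$, an $n$-Legendrian rack is a rack such that $x^{2n+2}=x$ for all $x$. Legendrian knots. $\xi_{std}=\ker(dz-y\,dx)$ on $\mathbb{R}^3$. A smooth knot $L$ is Legendrian if $T_pL\subset\xi_{std}|_p$ for all $p\in L$. A Legendrian isotopy is an isotopy through Legendrian knots. $L$ is topologically trivial (a Legendrian unknot) if it is topologically isotopic to the unknot. A front projection $D_L$ of $L$ is a generic projection to the $xz$-plane (obtained after a Legendrian isotopy if necessary): it has no vertical tangencies, finitely many cusps, and finitely many transverse double points (crossings). Since $y=dz/dx$, at each crossing the branch with smaller slope $dz/dx$ is the over-branch. The associated racks. The strands of an oriented front projection $D_L$ are the connected segments of the diagram that begin and end at an under-crossing or a cusp. $LR_n(D_L)$ is the $n$-Legendrian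 rack presented (in the class of $n$-Legendrian racks) by one generator for each strand and the following relations. At each crossing with over-strand $y$, incoming under-strand $x$ and outgoing under-strand $x'$: $x'=x*y$ if the crossing is positive and $x'=x/y$ if it is negative. At each cusp at which the strand $a$ is followed, along the orientation, by the strand $b$: $b=a^{n+1}$. Up to isomorphism $LR_n(D_L)$ depends only on the oriented Legendrian isotopy class of $L$, and is denoted $LR_n(L)$; $\mathcal{LR}(L)=(LR_n(L))_{n\in\mathbb{N}}$. $s_{min}$. Every topologically trivial Legendrian knot has a front projection with no crossings (a minimal diagram); the number of strands of such a diagram (equivalently its number of cusps) depends only on $L$ and is denoted $s_{min}(L)$. One has $s_{min}(L)=2|tb(L)|$, where $tb$ is the Thurston-Bennequin number (writhe minus half the number of cusps of a front). *)

theory Defs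
  imports "HOL-Analysis.Analysis" "HOL-Computational_Algebra.Primes"
begin

section \<open>Racks\<close>

record 'a rack_ops =
  elems :: "'a set"
  star :: "'a \<Rightarrow> 'a \<Rightarrow> 'a"
  slash :: "'a \<Rightarrow> 'a \<Rightarrow> 'a"

definition rack :: "'a rack_ops \<Rightarrow> bool" where
  "rack R \<longleftrightarrow>
     (\<forall>x\<in>elems R. \<forall>y\<in>elems R. star R x y \<in> elems R \<and> slash R x y \<in> elems R) \<and>
     (\<forall>x\<in>elems R. \<forall>y\<in>elems R. \<forall>z\<in>elems R.
        star R (star R x y) z = star R (star R x z) (star R y z) \<and>
        slash R (slash R x y) z = slash R (slash R x z) (slash R y z)) \<and>
     (\<forall>x\<in>elems R. \<forall>y\<in>elems R.
        slash R (star R x y) y = x \<and> star R (slash R x y) y = x)"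

text \<open>
  Powers \<open>x\<^sup>1 = x\<close> and \<open>x\<^sup>m = x\<^sup>m\<^sup>-\<^sup>1 * x\<close> for \<open>m > 1\<close>, for the binary operation \<open>f\<close>.
  The value for exponent \<open>0\<close> is a dummy.
\<close>

fun rpow :: "('a \<Rightarrow> 'a \<Rightarrow> 'a) \<Rightarrow> 'a \<Rightarrow> nat \<Rightarrow> 'a" where
  "rpow f x 0 = x"
| "rpow f x (Suc 0) = x"
| "rpow f x (Suc (Suc m)) = f (rpow f x (Suc m)) x"

definition legendrian_rack :: "nat \<Rightarrow> 'a rack_ops \<Rightarrow> bool" where
  "legendrian_rack n R \<longleftrightarrow> rack R \<and> (\<forall>x\<in>elems R. rpow (star R) x (2 * n + 2) = x)"

definition rack_hom :: "'a rack_ops \<Rightarrow> 'b rack_ops \<Rightarrow> ('a \<Rightarrow> 'b) \<Rightarrow> bool" where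
  "rack_hom R S h \<longleftrightarrow> h ` elems R \<subseteq> elems S \<and>
     (\<forall>x\<in>elems R. \<forall>y\<in>elems R.
        h (star R x y) = star S (h x) (h y) \<and> h (slash R x y) = slash S (h x) (h y))"

definition rack_iso :: "'a rack_ops \<Rightarrow> 'b rack_ops \<Rightarrow> bool" where
  "rack_iso R S \<longleftrightarrow> (\<exists>h. rack_hom R S h \<and> bij_betw h (elems R) (elems S))"

subsection \<open>Presentations in the class of \<open>n\<close>-Legendrian racks\<close>

datatype 'g rterm = Gen 'g | Star "'g rterm" "'g rterm" | Slash "'g rterm" "'g rterm"

definition rterms :: "'g set \<Rightarrow> 'g rterm set" where
  "rterms X = {t. set_rterm t \<subseteq> X}"

text \<open>
  The congruence on the terms over the generators \<open>X\<close> that is generated by the identities of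
  \<open>n\<close>-Legendrian racks together with the relations \<open>rels\<close>.
\<close>

inductive pcong :: "nat \<Rightarrow> 'g set \<Rightarrow> ('g rterm \<times> 'g rterm) set \<Rightarrow> 'g rterm \<Rightarrow> 'g rterm \<Rightarrow> bool"
  for n X rels where
  rel: "(s, t) \<in> rels \<Longrightarrow> s \<in> rterms X \<Longrightarrow> t \<in> rterms X \<Longrightarrow> pcong n X rels s t"
| refl: "t \<in> rterms X \<Longrightarrow> pcong n X rels t t"
| sym: "pcong n X rels s t \<Longrightarrow> pcong n X rels t s"
| trans: "pcong n X rels s t \<Longrightarrow> pcong n X rels t u \<Longrightarrow> pcong n X rels s u"
| star: "pcong n X rels s s' \<Longrightarrow> pcong n X rels t t' \<Longrightarrow>
    pcong n X rels (Star s t) (Star s' t')"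
| slash: "pcong n X rels s s' \<Longrightarrow> pcong n X rels t t' \<Longrightarrow>
    pcong n X rels (Slash s t) (Slash s' t')"
| star_distrib: "s \<in> rterms X \<Longrightarrow> t \<in> rterms X \<Longrightarrow> u \<in> rterms X \<Longrightarrow>
    pcong n X rels (Star (Star s t) u) (Star (Star s u) (Star t u))"
| slash_distrib: "s \<in> rterms X \<Longrightarrow> t \<in> rterms X \<Longrightarrow> u \<in> rterms X \<Longrightarrow>
    pcong n X rels (Slash (Slash s t) u) (Slash (Slash s u) (Slash t u))"
| slash_star: "s \<in> rterms X \<Longrightarrow> t \<in> rterms X \<Longrightarrow> pcong n X rels (Slash (Star s t) t) s"
| star_slash: "s \<in> rterms X \<Longrightarrow> t \<in> rterms X \<Longrightarrow> pcong n X rels (Star (Slash s t) t) s"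
| legendrian: "t \<in> rterms X \<Longrightarrow> pcong n X rels (rpow Star t (2 * n + 2)) t"

definition presented_rack ::
    "nat \<Rightarrow> 'g set \<Rightarrow> ('g rterm \<times> 'g rterm) set \<Rightarrow> 'g rterm set rack_ops" where
  "presented_rack n X rels =
     \<lparr> elems = {{u. pcong n X rels t u} | t. t \<in> rterms X},
       star = (\<lambda>A B. \<Union>a\<in>A. \<Union>b\<in>B. {u. pcong n X rels (Star a b) u}),
       slash = (\<lambda>A B. \<Union>a\<in>A. \<Union>b\<in>B. {u. pcong n X rels (Slash a b) u}) \<rparr>"

definition pclass :: "nat \<Rightarrow> 'g set \<Rightarrow> ('g rterm \<times> 'g rterm) set \<Rightarrow> 'g rterm \<Rightarrow> 'g rterm set" where
  "pclass n X rels t = {u. pcong n X rels t u}"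

lemma pclass_eq_iff: "t \<in> rterms X \<Longrightarrow> pclass n X rels s = pclass n X rels t \<longleftrightarrow> pcong n X rels s t"
  unfolding pclass_def
  by (auto intro: pcong.refl pcong.sym pcong.trans)

lemma presented_rack_simps:
  "elems (presented_rack n X rels) = pclass n X rels ` rterms X"
  "s \<in> rterms X \<Longrightarrow> t \<in> rterms X \<Longrightarrow>
     star (presented_rack n X rels) (pclass n X rels s) (pclass n X rels t) =
     pclass n X rels (Star s t)"
  "s \<in> rterms X \<Longrightarrow> t \<in> rterms X \<Longrightarrow>
     slash (presented_rack n X rels) (pclass n X rels s) (pclass n X rels t) =
     pclass n X rels (Slash s t)"
  unfolding presented_rack_def pclass_def
  by (auto intro: pcong.refl pcong.sym pcong.trans pcong.star pcong.slash)

lemma rterms_ops: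
  "s \<in> rterms X \<Longrightarrow> t \<in> rterms X \<Longrightarrow> Star s t \<in> rterms X"
  "s \<in> rterms X \<Longrightarrow> t \<in> rterms X \<Longrightarrow> Slash s t \<in> rterms X"
  "x \<in> X \<Longrightarrow> Gen x \<in> rterms X"
  by (auto simp: rterms_def)

lemma rpow_Suc: "m > 0 \<Longrightarrow> rpow f x (Suc m) = f (rpow f x m) x"
  by (cases m) auto

lemma rpow_rterms: "t \<in> rterms X \<Longrightarrow> rpow Star t m \<in> rterms X"
proof (induction m)
  case (Suc m)
  then show ?case by (cases "m = 0") (auto simp: rpow_Suc rterms_ops)
qed simp

lemma rpow_presented_rack:
  assumes "t \<in> rterms X"
  shows "rpow (star (presented_rack n X rels)) (pclass n X rels t) m =
         pclass n X rels (rpow Star t m)"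
proof (induction m)
  case (Suc m)
  then show ?case
    using assms by (cases "m = 0") (auto simp: rpow_Suc presented_rack_simps rpow_rterms)
qed simp

lemma legendrian_presented_rack: "legendrian_rack n (presented_rack n X rels)"
proof -
  have *: "rpow (star (presented_rack n X rels)) x (2 * n + 2) = x"
    if "x \<in> elems (presented_rack n X rels)" for x
  proof -
    from that obtain t where t: "t \<in> rterms X" "x = pclass n X rels t"
      by (auto simp: presented_rack_simps)
    show ?thesis
      unfolding t(2) rpow_presented_rack[OF t(1)] pclass_eq_iff[OF t(1)]
      using t(1) by (rule pcong.legendrian)
  qed
  have "rack (presented_rack n X rels)"
    unfolding rack_def presented_rack_simps(1) ball_simps
    by (intro conjI ballI)
      (simp_all add: presented_rack_simps rterms_ops pclass_eq_iff
        pcong.star_distrib pcong.slash_distrib pcong.slash_star pcong.star_slash)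
  with * show ?thesis by (simp only: legendrian_rack_def) blast
qed

primrec rterm_val :: "'a rack_ops \<Rightarrow> ('g \<Rightarrow> 'a) \<Rightarrow> 'g rterm \<Rightarrow> 'a" where
  "rterm_val R g (Gen x) = g x"
| "rterm_val R g (Star s t) = star R (rterm_val R g s) (rterm_val R g t)"
| "rterm_val R g (Slash s t) = slash R (rterm_val R g s) (rterm_val R g t)"

text \<open>The universal property of the presented rack.\<close>

lemma presented_rack_universal:
  assumes R: "legendrian_rack n R" and g: "g ` X \<subseteq> elems R"
    and rels: "\<And>s t. (s, t) \<in> rels \<Longrightarrow> s \<in> rterms X \<Longrightarrow> t \<in> rterms X \<Longrightarrow>
      rterm_val R g s = rterm_val R g t"
  obtains h where "rack_hom (presented_rack n X rels) R h"
    and "\<And>x. x \<in> X \<Longrightarrow> h (pclass n X rels (Gen x)) = g x"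
    and "\<And>h'. rack_hom (presented_rack n X rels) R h' \<Longrightarrow>
      (\<And>x. x \<in> X \<Longrightarrow> h' (pclass n X rels (Gen x)) = g x) \<Longrightarrow>
      \<forall>A \<in> elems (presented_rack n X rels). h' A = h A"
proof -
  let ?v = "rterm_val R g"
  have closed: "star R x y \<in> elems R" "slash R x y \<in> elems R"
    if "x \<in> elems R" "y \<in> elems R" for x y
    using R that unfolding legendrian_rack_def rack_def by blast+
  have v: "?v t \<in> elems R" if "t \<in> rterms X" for t
    using that g by (induction t) (auto simp: rterms_def closed)
  have vpow: "?v (rpow Star t m) = rpow (star R) (?v t) m" for t m
  proof (induction m)
    case (Suc m)
    then show ?case by (cases "m = 0") (auto simp: rpow_Suc)
  qed simp
  have wd: "?v s = ?v t" if "pcong n X rels s t" for s t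
    using that
  proof (induction rule: pcong.induct)
    case (legendrian t)
    then show ?case using v[of t] R unfolding vpow legendrian_rack_def by blast
  next
    case (star_distrib s t u)
    then show ?case using v[of s] v[of t] v[of u] R
      unfolding legendrian_rack_def rack_def rterm_val.simps by blast
  next
    case (slash_distrib s t u)
    then show ?case using v[of s] v[of t] v[of u] R
      unfolding legendrian_rack_def rack_def rterm_val.simps by blast
  next
    case (slash_star s t)
    then show ?case using v[of s] v[of t] R
      unfolding legendrian_rack_def rack_def rterm_val.simps by blast
  next
    case (star_slash s t)
    then show ?case using v[of s] v[of t] R
      unfolding legendrian_rack_def rack_def rterm_val.simps by blast
  qed (auto simp: rels)
  define h where "h A = ?v (SOME t. t \<in> A)" for A
  have h: "h (pclass n X rels t) = ?v t" if "t \<in> rterms X" for t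
  proof -
    have "t \<in> pclass n X rels t" using that by (simp add: pclass_def pcong.refl)
    then have "(SOME u. u \<in> pclass n X rels t) \<in> pclass n X rels t" by (rule someI)
    then show ?thesis using wd by (simp add: h_def pclass_def)
  qed
  show ?thesis
  proof (rule that[of h])
    show "rack_hom (presented_rack n X rels) R h"
      unfolding rack_hom_def using v by (auto simp: presented_rack_simps h rterms_ops)
    show "h (pclass n X rels (Gen x)) = g x" if "x \<in> X" for x
      using that h[of "Gen x"] by (simp add: rterms_ops)
    fix h' assume h': "rack_hom (presented_rack n X rels) R h'"
      "\<And>x. x \<in> X \<Longrightarrow> h' (pclass n X rels (Gen x)) = g x"
    have "h' (pclass n X rels t) = ?v t" if "t \<in> rterms X" for t
      using that
    proof (induction t)
      case (Star s t)
      then have st: "s \<in> rterms X" "t \<in> rterms X" by (auto simp: rterms_def)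
      have "h' (pclass n X rels (Star s t)) = star R (h' (pclass n X rels s)) (h' (pclass n X rels t))"
        using h'(1) st unfolding rack_hom_def
        by (metis imageI presented_rack_simps(1,2))
      then show ?case using Star st by simp
    next
      case (Slash s t)
      then have st: "s \<in> rterms X" "t \<in> rterms X" by (auto simp: rterms_def)
      have "h' (pclass n X rels (Slash s t)) = slash R (h' (pclass n X rels s)) (h' (pclass n X rels t))"
        using h'(1) st unfolding rack_hom_def
        by (metis imageI presented_rack_simps(1,3))
      then show ?case using Slash st by simp
    qed (use h'(2) in \<open>auto simp: rterms_def\<close>)
    then show "\<forall>A \<in> elems (presented_rack n X rels). h' A = h A"
      using h by (auto simp: presented_rack_simps)
  qed
qed



section \<open>Legendrian knots\<close>

primrec ck :: "nat \<Rightarrow> ('a::real_normed_vector \<Rightarrow> 'b::real_normed_vector) \<Rightarrow> bool" where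
  "ck 0 f \<longleftrightarrow> continuous_on UNIV f"
| "ck (Suc k) f \<longleftrightarrow>
     (\<forall>x. f differentiable (at x)) \<and> (\<forall>v. ck k (\<lambda>x. frechet_derivative f (at x) v))"

definition smooth :: "('a::real_normed_vector \<Rightarrow> 'b::real_normed_vector) \<Rightarrow> bool" where
  "smooth f \<longleftrightarrow> (\<forall>k. ck k f)"

text \<open>
  An oriented knot is given by a regular \<open>1\<close>-periodic parametrisation. The coordinates
  \<open>(x, y, z)\<close> of \<open>\<real>\<^sup>3\<close> are the components \<open>$1\<close>, \<open>$2\<close>, \<open>$3\<close>. Isotopies of parametrised knots
  include the orientation preserving reparametrisations.
\<close>

definition knot :: "(real \<Rightarrow> real^3) \<Rightarrow> bool" where
  "knot \<gamma> \<longleftrightarrow> smooth \<gamma> \<and> (\<forall>t. \<gamma> (t + 1) = \<gamma> t) \<and> inj_on \<gamma> {0..<1} \<and>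
     (\<forall>t. vector_derivative \<gamma> (at t) \<noteq> 0)"

text \<open>The velocity lies in \<open>\<xi>\<^sub>s\<^sub>t\<^sub>d = ker (dz - y dx)\<close>.\<close>

definition legendrian_knot :: "(real \<Rightarrow> real^3) \<Rightarrow> bool" where
  "legendrian_knot \<gamma> \<longleftrightarrow> knot \<gamma> \<and>
     (\<forall>t. vector_derivative \<gamma> (at t) $ 3 - \<gamma> t $ 2 * vector_derivative \<gamma> (at t) $ 1 = 0)"

definition isotopic_through ::
    "((real \<Rightarrow> real^3) \<Rightarrow> bool) \<Rightarrow> (real \<Rightarrow> real^3) \<Rightarrow> (real \<Rightarrow> real^3) \<Rightarrow> bool" where
  "isotopic_through P \<gamma> \<delta> \<longleftrightarrow> (\<exists>H :: real \<times> real \<Rightarrow> real^3. smooth H \<and>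
     (\<forall>\<tau>\<in>{0..1}. P (\<lambda>t. H (\<tau>, t))) \<and> (\<forall>t. H (0, t) = \<gamma> t) \<and> (\<forall>t. H (1, t) = \<delta> t))"

text \<open>
  Knot type is understood in the usual sense, as isotopy through smooth knots: isotopies through
  merely continuous embeddings would identify all tame knots.
\<close>

definition topologically_trivial :: "(real \<Rightarrow> real^3) \<Rightarrow> bool" where
  "topologically_trivial \<gamma> \<longleftrightarrow>
     isotopic_through knot \<gamma> (\<lambda>t. vector [cos (2 * pi * t), sin (2 * pi * t), 0])"


section \<open>Front projections\<close>

text \<open>
  A front in the \<open>xz\<close>-plane is represented by the Legendrian knot that projects to it; the
  coordinate \<open>y\<close> is the slope \<open>dz/dx\<close> of the front. The velocity of the front at parameter \<open>t\<close> is
  \<open>(front_dx \<gamma> t, front_dz \<gamma> t)\<close>.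
\<close>

definition front_dx :: "(real \<Rightarrow> real^3) \<Rightarrow> real \<Rightarrow> real" where
  "front_dx \<gamma> t = vector_derivative \<gamma> (at t) $ 1"

definition front_dz :: "(real \<Rightarrow> real^3) \<Rightarrow> real \<Rightarrow> real" where
  "front_dz \<gamma> t = vector_derivative \<gamma> (at t) $ 3"

definition same_front_point :: "(real \<Rightarrow> real^3) \<Rightarrow> real \<Rightarrow> real \<Rightarrow> bool" where
  "same_front_point \<gamma> s t \<longleftrightarrow> \<gamma> s $ 1 = \<gamma> t $ 1 \<and> \<gamma> s $ 3 = \<gamma> t $ 3"

definition cusp :: "(real \<Rightarrow> real^3) \<Rightarrow> real \<Rightarrow> bool" where
  "cusp \<gamma> t \<longleftrightarrow> front_dx \<gamma> t = 0 \<and> front_dz \<gamma> t = 0"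

text \<open>
  The front passes under at parameter \<open>u\<close> and over at parameter \<open>v\<close> of the same double point:
  the branch with the smaller slope is the over-branch.
\<close>

definition crossing :: "(real \<Rightarrow> real^3) \<Rightarrow> real \<Rightarrow> real \<Rightarrow> bool" where
  "crossing \<gamma> u v \<longleftrightarrow> same_front_point \<gamma> u v \<and> \<gamma> v $ 2 < \<gamma> u $ 2"

text \<open>
  The \<open>y\<close>-axis points away from a viewer who sees \<open>x\<close> pointing right and \<open>z\<close> pointing up, so
  the orientation \<open>(x, z)\<close> of the plane gives the usual sign of a crossing as the sign of the
  determinant of the over-velocity and the under-velocity.
\<close>

definition crossing_det :: "(real \<Rightarrow> real^3) \<Rightarrow> real \<Rightarrow> real \<Rightarrow> real" where
  "crossing_det \<gamma> u v = front_dx \<gamma> v * front_dz \<gamma> u - front_dz \<gamma> v * front_dx \<gamma> u"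

definition crossings :: "(real \<Rightarrow> real^3) \<Rightarrow> (real \<times> real) set" where
  "crossings \<gamma> = {(u, v). u \<in> {0..<1} \<and> v \<in> {0..<1} \<and> crossing \<gamma> u v}"

text \<open>
  The front is generic: its singular points are finitely many semicubical cusps, and its multiple
  points are finitely many transverse double points. Vertical tangencies are impossible since
  \<open>dz = y dx\<close>, and transversality excludes cusps at double points.
\<close>

definition generic_front :: "(real \<Rightarrow> real^3) \<Rightarrow> bool" where
  "generic_front \<gamma> \<longleftrightarrow>
     finite {t\<in>{0..<1}. cusp \<gamma> t} \<and>
     (\<forall>t. cusp \<gamma> t \<longrightarrow> deriv (front_dx \<gamma>) t \<noteq> 0) \<and>
     finite (crossings \<gamma>) \<and>
     (\<forall>u v. crossing \<gamma> u v \<longrightarrow> crossing_det \<gamma> u v \<noteq> 0) \<and>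
     (\<forall>r s t. same_front_point \<gamma> r s \<and> same_front_point \<gamma> s t \<longrightarrow>
        \<gamma> r = \<gamma> s \<or> \<gamma> s = \<gamma> t \<or> \<gamma> r = \<gamma> t)"

definition front_projection :: "(real \<Rightarrow> real^3) \<Rightarrow> (real \<Rightarrow> real^3) \<Rightarrow> bool" where
  "front_projection L D \<longleftrightarrow> isotopic_through legendrian_knot L D \<and> generic_front D"

subsection \<open>Strands and associated racks\<close>

definition break_points :: "(real \<Rightarrow> real^3) \<Rightarrow> real set" where
  "break_points D = {t. cusp D t} \<union> {u. \<exists>v. crossing D u v}"

text \<open>
  The strands are taken without their end points, and on the knot instead of the plane, so that
  they are not joined to the strands that cross over them.
\<close>

definition strands :: "(real \<Rightarrow> real^3) \<Rightarrow> (real^3) set set" where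
  "strands D = components (range D - D ` break_points D)"

definition incoming :: "(real \<Rightarrow> real^3) \<Rightarrow> real \<Rightarrow> (real^3) set \<Rightarrow> bool" where
  "incoming D t a \<longleftrightarrow> a \<in> strands D \<and> (\<forall>\<^sub>F s in at_left t. D s \<in> a)"

definition outgoing :: "(real \<Rightarrow> real^3) \<Rightarrow> real \<Rightarrow> (real^3) set \<Rightarrow> bool" where
  "outgoing D t a \<longleftrightarrow> a \<in> strands D \<and> (\<forall>\<^sub>F s in at_right t. D s \<in> a)"

definition front_relations ::
    "nat \<Rightarrow> (real \<Rightarrow> real^3) \<Rightarrow> ((real^3) set rterm \<times> (real^3) set rterm) set" where
  "front_relations n D =
     {(Gen x', Star (Gen x) (Gen y)) | x x' y u v. crossing D u v \<and> crossing_det D u v > 0 \<and>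
        incoming D u x \<and> outgoing D u x' \<and> y \<in> strands D \<and> D v \<in> y} \<union>
     {(Gen x', Slash (Gen x) (Gen y)) | x x' y u v. crossing D u v \<and> crossing_det D u v < 0 \<and>
        incoming D u x \<and> outgoing D u x' \<and> y \<in> strands D \<and> D v \<in> y} \<union>
     {(Gen b, rpow Star (Gen a) (n + 1)) | a b t. cusp D t \<and> incoming D t a \<and> outgoing D t b}"

definition LR_front :: "nat \<Rightarrow> (real \<Rightarrow> real^3) \<Rightarrow> (real^3) set rterm set rack_ops" where
  "LR_front n D = presented_rack n (strands D) (front_relations n D)"

text \<open>
  Up to isomorphism the racks of a front projection depend only on the oriented Legendrian isotopy
  class of the knot, so they may be read off from any front projection. The representative used
  here is one with the fewest crossings.
\<close>

definition front_of :: "(real \<Rightarrow> real^3) \<Rightarrow> (real \<Rightarrow> real^3)" where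
  "front_of L = arg_min (\<lambda>D. card (crossings D)) (front_projection L)"

definition LR :: "nat \<Rightarrow> (real \<Rightarrow> real^3) \<Rightarrow> (real^3) set rterm set rack_ops" where
  "LR n L = LR_front n (front_of L)"

subsection \<open>Minimal diagrams\<close>

definition minimal_diagram :: "(real \<Rightarrow> real^3) \<Rightarrow> (real \<Rightarrow> real^3) \<Rightarrow> bool" where
  "minimal_diagram L D \<longleftrightarrow> front_projection L D \<and> crossings D = {}"

text \<open>
  \<open>s_min\<close> is a partial function of the knot, defined on the knots that have a minimal diagram
  (among them the topologically trivial ones); \<open>has_s_min L s\<close> says that its value at \<open>L\<close> is \<open>s\<close>.
\<close>

definition has_s_min :: "(real \<Rightarrow> real^3) \<Rightarrow> nat \<Rightarrow> bool" where
  "has_s_min L s \<longleftrightarrow> (\<exists>D. minimal_diagram L D) \<and>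
     (\<forall>D. minimal_diagram L D \<longrightarrow> card (strands D) = s)"

end

theory Submission
  imports Defs "HOL-Library.Periodic_Fun"
begin

text \<open>
  In a rack all powers of an element \<open>x\<close> act like \<open>x\<close>, so \<open>(x\<^sup>i)\<^sup>j = x\<^sup>i\<^sup>+\<^sup>j\<^sup>-\<^sup>1\<close>. A crossingless front with
  \<open>s\<close> cusps is cut by them into a cycle of strands, each of which is the \<open>(n + 1)\<close>-st power of its
  predecessor. Hence its rack is generated by a single element \<open>x\<close> with \<open>x\<^sup>s\<^sup>n\<^sup>+\<^sup>1 = x\<close> and
  \<open>x\<^sup>2\<^sup>n\<^sup>+\<^sup>2 = x\<close>, and it is a cyclic rack with \<open>gcd (2n + 1) (sn) = gcd (2n + 1) s\<close> elements. For
  \<open>2n + 1 = p\<^sup>k\<close> this number detects whether \<open>p\<^sup>k\<close> divides \<open>s\<close>.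
\<close>

section \<open>Powers and cyclic racks\<close>

lemma rackD:
  assumes "rack R" "x \<in> elems R" "y \<in> elems R"
  shows "star R x y \<in> elems R" "slash R x y \<in> elems R"
    "slash R (star R x y) y = x" "star R (slash R x y) y = x"
    "z \<in> elems R \<Longrightarrow> star R (star R x y) z = star R (star R x z) (star R y z)"
  using assms unfolding rack_def by blast+

lemma rpow_mem:
  assumes "rack R" "x \<in> elems R"
  shows "rpow (star R) x j \<in> elems R"
proof (induction j)
  case (Suc j)
  then show ?case
    using assms by (cases "j = 0") (auto simp: rpow_Suc rackD(1))
qed (use assms in simp)

text \<open>All powers of \<open>x\<close> act like \<open>x\<close> itself: \<open>y * (a * x) = ((y / x) * a) * x\<close>.\<close>

lemma star_rpow:
  assumes R: "rack R" and x: "x \<in> elems R" and "y \<in> elems R"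
  shows "star R y (rpow (star R) x j) = star R y x"
  using \<open>y \<in> elems R\<close>
proof (induction j arbitrary: y)
  case (Suc j)
  show ?case
  proof (cases "j = 0")
    case False
    let ?a = "rpow (star R) x j" and ?z = "slash R y x"
    have z: "?z \<in> elems R" using R Suc.prems x by (rule rackD)
    have "star R (star R ?z ?a) x = star R (star R ?z x) (star R ?a x)"
      using R z rpow_mem[OF R x] x by (rule rackD)
    then show ?thesis
      using False Suc.IH[OF z] rackD(4)[OF R Suc.prems x] by (simp add: rpow_Suc)
  qed simp
qed simp

text \<open>Dividing by an element inverts multiplying by it, so \<open>star_rpow\<close> carries
  over to \<open>slash\<close>.\<close>

lemma slash_rpow:
  assumes R: "rack R" and x: "x \<in> elems R" and y: "y \<in> elems R"
  shows "slash R y (rpow (star R) x j) = slash R y x"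
proof -
  have z: "slash R y x \<in> elems R" using R y x by (rule rackD)
  show ?thesis
    using rackD(3)[OF R z rpow_mem[OF R x]] star_rpow[OF R x z] rackD(4)[OF R y x] by metis
qed

lemma star_rpow_rpow:
  assumes "rack R" "x \<in> elems R"
  shows "star R (rpow (star R) x (Suc i)) (rpow (star R) x j) = rpow (star R) x (Suc (Suc i))"
  by (simp add: star_rpow[OF assms rpow_mem[OF assms]])

text \<open>Every power acts like \<open>x\<close>, so only the number of multiplications counts.
  The exponent \<open>Suc i\<close> stands for \<open>i\<close> multiplications, and these numbers
  add up; writing exponents as successors also keeps away from the dummy exponent 0.\<close>

lemma rpow_rpow:
  assumes "rack R" "x \<in> elems R"
  shows "rpow (star R) (rpow (star R) x (Suc i)) (Suc j) = rpow (star R) x (Suc (i + j))"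
proof (induction j)
  case (Suc j)
  then show ?case using star_rpow_rpow[OF assms, of "i + j"] by (simp add: rpow_Suc)
qed simp

lemma rpow_add_period:
  assumes R: "rack R" and x: "x \<in> elems R" and k: "rpow (star R) x (Suc k) = x"
  shows "rpow (star R) x (Suc (i + j * k)) = rpow (star R) x (Suc i)"
proof (induction j)
  case (Suc j)
  have "rpow (star R) x (Suc (i + Suc j * k)) =
      rpow (star R) (rpow (star R) x (Suc k)) (Suc (i + j * k))"
    unfolding rpow_rpow[OF R x] by (simp add: add_ac)
  then show ?case using Suc k by simp
qed simp

text \<open>Both hypotheses give periods of the sequence of powers of \<open>x\<close>, and Bezout's
  identity combines them to their gcd.\<close>

lemma rpow_add_gcd:
  assumes R: "rack R" and x: "x \<in> elems R" and "k > 0"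
    and k: "rpow (star R) x (Suc k) = x" and l: "rpow (star R) x (Suc l) = x"
  shows "rpow (star R) x (Suc (gcd k l)) = x"
proof -
  \<comment> \<open>Over the natural numbers Bezout's identity is one-sided; this orientation
    requires \<open>k\<close> to be nonzero.\<close>
  obtain u v where uv: "k * u = l * v + gcd k l"
    using bezout_nat[of k l] \<open>k > 0\<close> by auto
  have "rpow (star R) x (Suc (gcd k l)) = rpow (star R) x (Suc (0 + u * k))"
    using rpow_add_period[OF R x l, of "gcd k l" v] uv by (simp add: mult_ac add_ac)
  then show ?thesis using rpow_add_period[OF R x k, of 0 u] by simp
qed

text \<open>The period is \<open>Suc k\<close>, so undoing one multiplication amounts to
  \<open>k\<close> further ones. Hence the powers of \<open>x\<close> are closed under
  \<open>slash\<close>.\<close>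

lemma slash_rpow_rpow:
  assumes R: "rack R" and x: "x \<in> elems R" and k: "rpow (star R) x (Suc (Suc k)) = x"
  shows "slash R (rpow (star R) x (Suc i)) (rpow (star R) x j) = rpow (star R) x (Suc (i + k))"
proof -
  have "rpow (star R) x (Suc i) = rpow (star R) x (Suc (Suc (i + k)))"
    using rpow_add_period[OF R x k, of i 1] by simp
  also have "\<dots> = star R (rpow (star R) x (Suc (i + k))) x" by simp
  finally show ?thesis
    using rackD(3)[OF R rpow_mem[OF R x] x] slash_rpow[OF R x rpow_mem[OF R x]] by metis
qed

text \<open>The permutation rack of the cyclic shift of the residues modulo \<open>d\<close>. Adding
  \<open>d - 1\<close> replaces subtracting 1, which would be truncated at 0.\<close>

definition cyclic_rack :: "nat \<Rightarrow> nat rack_ops" where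
  "cyclic_rack d = \<lparr> elems = {..<d}, star = (\<lambda>x y. (x + 1) mod d),
     slash = (\<lambda>x y. (x + (d - 1)) mod d) \<rparr>"

lemma cyclic_rack_simps:
  "elems (cyclic_rack d) = {..<d}" "star (cyclic_rack d) x y = (x + 1) mod d"
  "slash (cyclic_rack d) x y = (x + (d - 1)) mod d"
  by (simp_all add: cyclic_rack_def)

lemma rack_cyclic_rack: "rack (cyclic_rack d)"
proof -
  have "(Suc x mod d + (d - 1)) mod d = x" "Suc ((x + (d - 1)) mod d) mod d = x" if "x < d" for x
  proof -
    have "(Suc x mod d + (d - 1)) mod d = (Suc x + (d - 1)) mod d"
      "Suc ((x + (d - 1)) mod d) mod d = Suc (x + (d - 1)) mod d"
      by (rule mod_add_left_eq mod_Suc_eq)+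
    moreover have "Suc x + (d - 1) = x + d" using that by simp
    ultimately show "(Suc x mod d + (d - 1)) mod d = x" "Suc ((x + (d - 1)) mod d) mod d = x"
      using that by simp_all
  qed
  then show ?thesis unfolding rack_def cyclic_rack_simps by simp
qed

lemma rpow_cyclic_rack:
  "x < d \<Longrightarrow> rpow (star (cyclic_rack d)) x (Suc j) = (x + j) mod d"
  by (induction j) (auto simp: cyclic_rack_simps mod_simps)

lemma legendrian_cyclic_rack:
  assumes "d dvd 2 * n + 1"
  shows "legendrian_rack n (cyclic_rack d)"
proof -
  have "(x + (2 * n + 1)) mod d = x" if "x < d" for x
    using assms that by (metis add_0_right dvd_imp_mod_0 mod_add_right_eq mod_less)
  then show ?thesis
    using rpow_cyclic_rack[of _ d "2 * n + 1"]
    by (simp add: legendrian_rack_def rack_cyclic_rack cyclic_rack_simps(1))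
qed

section \<open>Presentations on a cycle of generators\<close>

lemma rterm_val_rpow: "rterm_val R g (rpow Star t m) = rpow (star R) (rterm_val R g t) m"
proof (induction m)
  case (Suc m)
  then show ?case by (cases "m = 0") (auto simp: rpow_Suc)
qed simp

text \<open>Upper bound: every element is a power of the class of \<open>A 0\<close>, and these
  powers have period \<open>d\<close>. Lower bound: the universal property yields a homomorphism
  onto the cyclic rack with \<open>d\<close> elements.\<close>

lemma card_cyclically_presented_rack:
  fixes A :: "nat \<Rightarrow> 'g"
  assumes m: "m > 0" and A: "\<And>i j. A i = A j \<longleftrightarrow> i mod m = j mod m"
  shows "card (elems (presented_rack n (range A)
      {(Gen (A (Suc i)), rpow Star (Gen (A i)) (n + 1)) | i. True})) = gcd (2 * n + 1) m"
proof -
  define X where "X = range A"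
  define rels where "rels = {(Gen (A (Suc i)), rpow Star (Gen (A i)) (n + 1)) | i. True}"
  define R where "R = presented_rack n X rels"
  \<comment> \<open>The two periods that arise are \<open>2 * n + 1\<close> and
    \<open>m * n\<close>. The factor \<open>n\<close> is coprime to the former and drops out of the
    gcd.\<close>
  define d where "d = gcd (2 * n + 1) (m * n)"
  have cop: "coprime (2 * n + 1) n"
    by (metis coprime_iff_gcd_eq_1 gcd_1_nat gcd_add_mult gcd.commute)
  then have d_eq: "d = gcd (2 * n + 1) m"
    by (simp add: d_def gcd_mult_right_right_cancel)
  have "d > 0" by (simp add: d_def)
  have leg: "legendrian_rack n R" and R: "rack R"
    using legendrian_presented_rack[of n X rels] by (auto simp: R_def legendrian_rack_def)
  have gen: "Gen (A i) \<in> rterms X" for i by (simp add: X_def rterms_ops)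
  define c where "c t = pclass n X rels t" for t
  have elems_R: "elems R = c ` rterms X"
    unfolding R_def c_def by (rule presented_rack_simps)
  define x where "x = c (Gen (A 0))"
  have x: "x \<in> elems R" using gen by (simp add: x_def elems_R)
  define P where "P j = rpow (star R) x (Suc j)" for j
  have "c (Gen (A (Suc i))) = rpow (star R) (c (Gen (A i))) (n + 1)" for i
    unfolding R_def c_def rpow_presented_rack[OF gen] pclass_eq_iff[OF rpow_rterms[OF gen]]
    by (rule pcong.rel) (auto simp: rels_def gen intro!: rpow_rterms simp del: rpow.simps)
  then have cA: "c (Gen (A i)) = P (i * n)" for i
    using rpow_rpow[OF R x, of "k * n" n for k]
    by (induction i) (simp_all add: P_def x_def add.commute del: rpow.simps(3))
  \<comment> \<open>One turn around the cycle takes \<open>m\<close> steps of \<open>n\<close>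
    multiplications each and leads back to the generator \<open>A 0\<close>.\<close>
  have "P (m * n) = x" using cA[of m] A[of m 0] by (simp add: x_def)
  moreover have leg_x: "P (2 * n + 1) = x"
    using leg x by (simp add: P_def legendrian_rack_def)
  ultimately have per: "rpow (star R) x (Suc d) = x"
    unfolding d_def P_def using rpow_add_gcd[OF R x, of "2 * n + 1" "m * n"] by simp
  \<comment> \<open>A product costs one more multiplication by \<open>x\<close>; a quotient costs
    \<open>2 * n\<close> more, because \<open>2 * n + 1\<close> is a period.\<close>
  have cP: "c t \<in> range P" if "t \<in> rterms X" for t
    using that
  proof (induction t)
    case (Gen a)
    then show ?case using cA by (auto simp: rterms_def X_def)
  next
    case (Star s t)
    then have st: "s \<in> rterms X" "t \<in> rterms X" by (auto simp: rterms_def)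
    then obtain i j where "c s = P i" "c t = P j" using Star by auto
    moreover have "c (Star s t) = star R (c s) (c t)"
      using st by (simp add: R_def c_def presented_rack_simps)
    ultimately have "c (Star s t) = P (Suc i)"
      using star_rpow_rpow[OF R x] by (simp only: P_def)
    then show ?case by simp
  next
    case (Slash s t)
    then have st: "s \<in> rterms X" "t \<in> rterms X" by (auto simp: rterms_def)
    then obtain i j where "c s = P i" "c t = P j" using Slash by auto
    moreover have "c (Slash s t) = slash R (c s) (c t)"
      using st by (simp add: R_def c_def presented_rack_simps)
    moreover have "rpow (star R) x (Suc (Suc (2 * n))) = x"
      using leg_x by (simp only: P_def Suc_eq_plus1)
    ultimately have "c (Slash s t) = P (i + 2 * n)"
      using slash_rpow_rpow[OF R x] by (simp only: P_def)
    then show ?case by simp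
  qed
  have "P i = P (i mod d)" for i
    using rpow_add_period[OF R x per, of "i mod d" "i div d"] by (simp add: P_def)
  then have "range P \<subseteq> P ` {..<d}" using \<open>d > 0\<close> by (metis image_subsetI imageI lessThan_iff mod_less_divisor)
  then have sub: "elems R \<subseteq> P ` {..<d}" using cP elems_R by auto
  then have fin: "finite (elems R)" by (rule finite_subset) simp
  have le: "card (elems R) \<le> d"
    using card_mono[OF _ sub] card_image_le[of "{..<d}" P] by simp
  let ?C = "cyclic_rack d"
  \<comment> \<open>If \<open>x\<close> is to be sent to 0, then \<open>cA\<close> forces the value
    \<open>i * n mod d\<close> at \<open>A i\<close>. The inverse of \<open>A\<close> selects the
    index below \<open>m\<close>.\<close>
  define g where "g a = ((inv_into {..<m} A a) * n) mod d" for a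
  have "inv_into {..<m} A (A i) = i mod m" for i
  proof -
    have "inj_on A {..<m}" using A by (simp add: inj_on_def)
    moreover have "A (i mod m) = A i" by (simp add: A)
    ultimately show ?thesis using inv_into_f_f[of A "{..<m}" "i mod m"] m by simp
  qed
  \<comment> \<open>Changing the index by a multiple of \<open>m\<close> changes the value by a
    multiple of \<open>m * n\<close>, hence of \<open>d\<close>.\<close>
  then have gA: "g (A i) = i * n mod d" for i
  proof -
    have "i * n = (i mod m) * n + (i div m) * (m * n)"
      by (metis add.commute div_mult_mod_eq distrib_right mult.assoc)
    moreover have "d dvd (i div m) * (m * n)" by (simp add: d_def)
    ultimately show ?thesis
      using \<open>inv_into {..<m} A (A i) = i mod m\<close> unfolding g_def
      by (metis add_0_right dvd_imp_mod_0 mod_add_right_eq)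
  qed
  obtain h where h: "rack_hom R ?C h" "\<And>a. a \<in> X \<Longrightarrow> h (c (Gen a)) = g a"
  proof (rule presented_rack_universal[of n ?C g X rels])
    show "legendrian_rack n ?C" by (rule legendrian_cyclic_rack) (simp add: d_def)
    show "g ` X \<subseteq> elems ?C" using \<open>d > 0\<close> by (auto simp: cyclic_rack_simps g_def)
    show "rterm_val ?C g s = rterm_val ?C g t" if st: "(s, t) \<in> rels" for s t
    proof -
      obtain i where "s = Gen (A (Suc i))" "t = rpow Star (Gen (A i)) (n + 1)"
        using st by (auto simp: rels_def)
      then show ?thesis
        using rpow_cyclic_rack[of "i * n mod d" d n] \<open>d > 0\<close>
        by (simp add: rterm_val_rpow gA mod_simps add.commute del: rpow.simps(3))
    qed
  qed (use that in \<open>auto simp: R_def c_def\<close>)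
  \<comment> \<open>The homomorphism counts multiplications by \<open>x\<close> modulo
    \<open>d\<close>, so it is onto.\<close>
  have hP: "h (P i) = i mod d" for i
  proof (induction i)
    case 0
    then show ?case using h(2)[of "A 0"] gA[of 0] by (simp add: P_def x_def X_def)
  next
    case (Suc i)
    have "h (star R (P i) x) = star ?C (h (P i)) (h x)"
      using h(1) x rpow_mem[OF R x] unfolding rack_hom_def P_def by blast
    then show ?case using Suc by (simp add: P_def cyclic_rack_simps mod_simps)
  qed
  have "{..<d} \<subseteq> h ` elems R"
  proof
    fix i assume "i \<in> {..<d}"
    then have "i = h (P i)" by (simp add: hP)
    then show "i \<in> h ` elems R" using rpow_mem[OF R x] unfolding P_def by blast
  qed
  then have "d \<le> card (elems R)"
    using card_mono[of "h ` elems R" "{..<d}"] card_image_le[OF fin, of h] fin by simp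
  with le show ?thesis by (simp add: d_eq R_def X_def rels_def)
qed

section \<open>Subdivided closed curves\<close>

lemma periodic_add_int:
  fixes f :: "real \<Rightarrow> 'a"
  assumes "\<And>t. f (t + 1) = f t"
  shows "f (t + of_int k) = f t"
proof -
  interpret periodic_fun_simple' f by standard (rule assms)
  show ?thesis by (rule plus_of_int)
qed

text \<open>Passing to fractional parts does not change the values of \<open>f\<close>, and
  injectivity on one period makes the fractional parts equal.\<close>

lemma inj_periodic_eqD:
  fixes f :: "real \<Rightarrow> 'a"
  assumes per: "\<And>t. f (t + 1) = f t" and inj: "inj_on f {0..<1}" and eq: "f s = f t"
  obtains k where "s = t + of_int k"
proof -
  have frac: "f (frac u) = f u" for u
    using periodic_add_int[of f u "- \<lfloor>u\<rfloor>"] per by (simp add: frac_def)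
  have "frac s = frac t"
    using inj by (rule inj_onD) (simp_all add: frac eq frac_lt_1)
  then have "s = t + of_int (\<lfloor>s\<rfloor> - \<lfloor>t\<rfloor>)" by (simp add: frac_def)
  then show thesis by (rule that)
qed

text \<open>The closed sets \<open>K\<close> and \<open>K'\<close> separate \<open>C\<close> from
  the rest of \<open>S\<close>: a connected \<open>d\<close> between \<open>C\<close> and
  \<open>S\<close> meets \<open>K\<close>, so it misses \<open>K'\<close> and lies in
  \<open>C\<close>.\<close>

lemma clopen_connected_in_components:
  fixes S :: "'a::topological_space set"
  assumes C: "C \<noteq> {}" "connected C" "C \<subseteq> S"
    and K: "closed K" "closed K'" "S \<subseteq> K \<union> K'" "S \<inter> K = C" "S \<inter> K' \<inter> C = {}"
  shows "C \<in> components S"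
  unfolding in_components_maximal
proof (intro conjI allI impI)
  fix d assume d: "d \<noteq> {} \<and> C \<subseteq> d \<and> d \<subseteq> S \<and> connected d"
  then have "K \<inter> d = {} \<or> K' \<inter> d = {}"
    using K by (intro connected_closedD) auto
  then show "d = C" using d K C by blast
qed (use C in auto)

text \<open>The division points are lifted to the line and listed without end, \<open>m\<close> per
  period. Consecutive arcs thus have consecutive indices, with no special case where the curve
  closes up.\<close>

locale subdivided_closed_curve =
  fixes f :: "real \<Rightarrow> 'a::metric_space" and \<tau> :: "nat \<Rightarrow> real" and m :: nat
  assumes cont: "continuous_on UNIV f" and per: "\<And>t. f (t + 1) = f t"
    and inj: "inj_on f {0..<1}" and m: "m > 0"
    and mono: "strict_mono \<tau>" and \<tau>_add: "\<And>i. \<tau> (i + m) = \<tau> i + 1"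
begin

definition arc :: "nat \<Rightarrow> 'a set" where
  "arc i = f ` {\<tau> i<..<\<tau> (Suc i)}"

lemmas f_add_int = periodic_add_int[of f, OF per]

lemma \<tau>_add_mult: "\<tau> (i + k * m) = \<tau> i + real k"
proof (induction k)
  case (Suc k)
  then show ?case using \<tau>_add[of "i + k * m"] by (simp add: algebra_simps)
qed simp

lemma arc_add_mult: "arc (i + k * m) = arc i"
proof -
  have "{\<tau> (i + k * m)<..<\<tau> (Suc (i + k * m))} = (\<lambda>t. t + of_int (int k)) ` {\<tau> i<..<\<tau> (Suc i)}"
    using \<tau>_add_mult[of i k] \<tau>_add_mult[of "Suc i" k]
    by (auto simp: image_iff intro!: bexI[of _ "x - real k" for x])
  then show ?thesis unfolding arc_def by (simp only: image_image f_add_int)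
qed

lemma arc_mod: "arc (i mod m) = arc i"
  using arc_add_mult[of "i mod m" "i div m"] by simp

lemma in_between_unique:
  assumes "\<tau> i \<le> t" "t < \<tau> (Suc i)" "\<tau> j \<le> t" "t < \<tau> (Suc j)"
  shows "i = j"
proof -
  have "\<tau> i < \<tau> (Suc j)" "\<tau> j < \<tau> (Suc i)" using assms by auto
  then show ?thesis using mono by (simp add: strict_mono_less)
qed

text \<open>Parameters with the same image differ by an integer, and integer translations shift the
  index by multiples of \<open>m\<close>. Half-open intervals treat arcs and division points
  together; the final equivalence tells them apart.\<close>

lemma image_Ico_meet:
  assumes s: "s \<in> {\<tau> i..<\<tau> (Suc i)}" and t: "t \<in> {\<tau> j..<\<tau> (Suc j)}" and eq: "f s = f t"
  shows "i mod m = j mod m \<and> (s = \<tau> i \<longleftrightarrow> t = \<tau> j)"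
proof -
  \<comment> \<open>Indices are natural numbers, so only shifts to the right are treated; a negative
    shift is handled by exchanging the two parameters.\<close>
  have *: "i = j + k * m \<and> (s = \<tau> i \<longleftrightarrow> t = \<tau> j)"
    if "s \<in> {\<tau> i..<\<tau> (Suc i)}" "t \<in> {\<tau> j..<\<tau> (Suc j)}" "s = t + real k" for s t i j k
  proof -
    have i: "i = j + k * m"
      using that \<tau>_add_mult[of j k] \<tau>_add_mult[of "Suc j" k]
      by (intro in_between_unique[of i s]) auto
    then show ?thesis using that \<tau>_add_mult[of j k] by simp
  qed
  obtain k where k: "s = t + of_int k" using inj_periodic_eqD[OF per inj eq] .
  show ?thesis
  proof (cases "k \<ge> 0")
    case True
    then show ?thesis using *[OF s t, of "nat k"] k by auto
  next
    case False
    then show ?thesis using *[OF t s, of "nat (- k)"] k by auto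
  qed
qed

lemma arcs_meet: "arc i \<inter> arc j \<noteq> {} \<longleftrightarrow> i mod m = j mod m"
proof
  assume "arc i \<inter> arc j \<noteq> {}"
  then obtain x where "x \<in> arc i" "x \<in> arc j" by blast
  then obtain s t where "s \<in> {\<tau> i<..<\<tau> (Suc i)}" "t \<in> {\<tau> j<..<\<tau> (Suc j)}" "f s = f t"
    unfolding arc_def by (metis imageE)
  then show "i mod m = j mod m" using image_Ico_meet[of s i t j] by auto
next
  assume "i mod m = j mod m"
  then have "arc i = arc j" by (metis arc_mod)
  moreover have "arc i \<noteq> {}" using mono by (simp add: arc_def not_le strict_mono_less)
  ultimately show "arc i \<inter> arc j \<noteq> {}" by simp
qed

lemma arc_eq_iff: "arc i = arc j \<longleftrightarrow> i mod m = j mod m"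
  using arcs_meet[of i j] arcs_meet[of i i] arc_mod by metis

text \<open>The list \<open>\<tau>\<close> starts at \<open>\<tau> 0\<close>, so a parameter is
  first translated by an integer to a place not before it.\<close>

lemma obtain_Ico:
  obtains k i where "t + of_int k \<in> {\<tau> i..<\<tau> (Suc i)}"
proof -
  obtain k where k: "\<tau> 0 - t \<le> of_int k" using ex_le_of_int by blast
  define u where "u = t + of_int k"
  have "\<exists>i. u < \<tau> i"
  proof -
    obtain l where "u - \<tau> 0 < real l" using reals_Archimedean2 by blast
    then show ?thesis using \<tau>_add_mult[of 0 l] by (intro exI[of _ "l * m"]) simp
  qed
  then obtain j where "u < \<tau> j" "\<And>i. i < j \<Longrightarrow> \<not> u < \<tau> i" using exists_least_iff[of "\<lambda>i. u < \<tau> i"] by auto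
  moreover have "\<tau> 0 \<le> u" using k by (simp add: u_def)
  ultimately have "u \<in> {\<tau> (j - 1)..<\<tau> (Suc (j - 1))}" by (cases j) (auto simp: not_less)
  then show thesis using that u_def by blast
qed

lemma range_minus_eq: "range f - f ` range \<tau> = (\<Union>i. arc i)"
proof (intro equalityI subsetI)
  fix x assume x: "x \<in> range f - f ` range \<tau>"
  then obtain t where t: "x = f t" by auto
  obtain k i where ki: "t + of_int k \<in> {\<tau> i..<\<tau> (Suc i)}" by (rule obtain_Ico)
  have "x = f (t + of_int k)" by (simp add: f_add_int t)
  moreover from this have "t + of_int k \<noteq> \<tau> i" using x by auto
  ultimately show "x \<in> (\<Union>i. arc i)" using ki unfolding arc_def by force
next
  fix x assume "x \<in> (\<Union>i. arc i)"
  then obtain i s where s: "s \<in> {\<tau> i<..<\<tau> (Suc i)}" "x = f s" by (auto simp: arc_def)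
  have "f s \<noteq> f (\<tau> j)" for j
    using image_Ico_meet[of s i "\<tau> j" j] s(1) mono by (auto simp: strict_mono_less)
  then show "x \<in> range f - f ` range \<tau>" using s by auto
qed

text \<open>The compact arc \<open>K i\<close> adds only division points to \<open>arc i\<close>. It
  and the union of the other compact arcs are the closed sets that separate \<open>arc i\<close>
  from the other arcs.\<close>

lemma components_eq: "components (range f - f ` range \<tau>) = range arc"
proof -
  let ?S = "range f - f ` range \<tau>"
  define K where "K i = f ` {\<tau> i..\<tau> (Suc i)}" for i
  have closed_K: "closed (K i)" for i
    unfolding K_def
    by (intro compact_imp_closed compact_continuous_image continuous_on_subset[OF cont]) auto
  have K: "K i \<inter> ?S = arc i" for i
  proof -
    have "{\<tau> i..\<tau> (Suc i)} = {\<tau> i, \<tau> (Suc i)} \<union> {\<tau> i<..<\<tau> (Suc i)}"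
      using mono by (auto simp: strict_mono_less_eq)
    then have "K i = {f (\<tau> i), f (\<tau> (Suc i))} \<union> arc i"
      unfolding K_def arc_def by (simp only: image_Un) simp
    moreover have "arc i \<subseteq> ?S" using range_minus_eq by blast
    ultimately show ?thesis by auto
  qed
  have comp: "arc i \<in> components ?S" for i
  proof (rule clopen_connected_in_components)
    \<comment> \<open>Keeping one index per arc makes the union finite and therefore closed.\<close>
    let ?K' = "\<Union>j \<in> {j. j < m \<and> j \<noteq> i mod m}. K j"
    show "arc i \<noteq> {}" using arcs_meet[of i i] by simp
    show "connected (arc i)"
      unfolding arc_def
      by (intro connected_continuous_image continuous_on_subset[OF cont]) auto
    show "arc i \<subseteq> ?S" using range_minus_eq by blast
    show "closed (K i)" by (rule closed_K)
    show "closed ?K'" by (intro closed_UN ballI closed_K) simp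
    show "?S \<inter> K i = arc i" using K by blast
    have sub: "arc j \<subseteq> K j" for j using K by blast
    show "?S \<subseteq> K i \<union> ?K'"
    proof
      fix x assume "x \<in> ?S"
      then obtain j where j: "x \<in> arc j" using range_minus_eq by blast
      show "x \<in> K i \<union> ?K'"
      proof (cases "j mod m = i mod m")
        case True
        then show ?thesis using j sub arc_eq_iff by blast
      next
        case False
        have "x \<in> K (j mod m)" using j sub arc_mod by blast
        moreover have "j mod m < m" using m by simp
        ultimately show ?thesis using False by blast
      qed
    qed
    show "?S \<inter> ?K' \<inter> arc i = {}"
    proof -
      have "arc j \<inter> arc i = {}" if "j < m" "j \<noteq> i mod m" for j
        using arcs_meet[of j i] that by auto
      then show ?thesis using K by blast
    qed
  qed
  show ?thesis
  proof
    show "range arc \<subseteq> components ?S" using comp by auto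
    show "components ?S \<subseteq> range arc"
    proof
      fix d assume d: "d \<in> components ?S"
      then obtain x where x: "x \<in> d" using in_components_nonempty by blast
      then have "x \<in> ?S" using d in_components_subset by blast
      then obtain i where "x \<in> arc i" using range_minus_eq by blast
      then have "d = arc i" using components_nonoverlap[OF d comp[of i]] x by blast
      then show "d \<in> range arc" by simp
    qed
  qed
qed

lemma eventually_at_left_in_arc: "\<forall>\<^sub>F s in at_left (\<tau> (Suc i) + of_int k). f s \<in> arc i"
proof -
  have "\<tau> i + of_int k < \<tau> (Suc i) + of_int k" using mono by (simp add: strict_mono_less)
  then show ?thesis
  proof (rule eventually_mono[OF eventually_at_left_real])
    fix s assume s: "s \<in> {\<tau> i + of_int k<..<\<tau> (Suc i) + of_int k}"
    have "f (s - of_int k) = f s" using f_add_int[of s "- k"] by simp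
    moreover have "s - of_int k \<in> {\<tau> i<..<\<tau> (Suc i)}" using s by auto
    ultimately show "f s \<in> arc i" unfolding arc_def by (metis imageI)
  qed
qed

lemma eventually_at_right_in_arc: "\<forall>\<^sub>F s in at_right (\<tau> i + of_int k). f s \<in> arc i"
proof -
  have "\<tau> i + of_int k < \<tau> (Suc i) + of_int k" using mono by (simp add: strict_mono_less)
  then show ?thesis
  proof (rule eventually_mono[OF eventually_at_right_real])
    fix s assume s: "s \<in> {\<tau> i + of_int k<..<\<tau> (Suc i) + of_int k}"
    have "f (s - of_int k) = f s" using f_add_int[of s "- k"] by simp
    moreover have "s - of_int k \<in> {\<tau> i<..<\<tau> (Suc i)}" using s by auto
    ultimately show "f s \<in> arc i" unfolding arc_def by (metis imageI)
  qed
qed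

text \<open>Distinct arcs are disjoint, so a nontrivial filter can settle in only one of them. With
  one-sided filters this determines the incoming and outgoing strands.\<close>

lemma eventually_in_arc_iff:
  assumes "F \<noteq> bot" "\<forall>\<^sub>F s in F. f s \<in> arc i"
  shows "a \<in> range arc \<and> (\<forall>\<^sub>F s in F. f s \<in> a) \<longleftrightarrow> a = arc i"
proof
  assume a: "a \<in> range arc \<and> (\<forall>\<^sub>F s in F. f s \<in> a)"
  then obtain j where j: "a = arc j" by auto
  have "\<forall>\<^sub>F s in F. f s \<in> arc j \<inter> arc i" using a assms(2) j by (simp add: eventually_conj_iff)
  then have "arc j \<inter> arc i \<noteq> {}"
    using assms(1) eventually_happens[of "\<lambda>s. f s \<in> arc j \<inter> arc i" F] by auto
  then show "a = arc i" by (simp add: arcs_meet arc_eq_iff j)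
qed (use assms in auto)

lemma card_arcs: "card (range arc) = m"
proof -
  have "range arc = arc ` {..<m}"
    using m by (metis (mono_tags, opaque_lifting) arc_mod image_eqI lessThan_iff mod_less_divisor
        subset_antisym image_subsetI rangeI)
  moreover have "inj_on arc {..<m}" by (simp add: inj_on_def arc_eq_iff)
  ultimately show ?thesis by (simp add: card_image)
qed

end

text \<open>The points in one period are sorted and the list is repeated with integer translations.
  The successor in the last conclusion makes each point the end of one arc and the start of the
  next.\<close>

lemma obtain_periodic_enumeration:
  fixes C :: "real set"
  assumes fin: "finite (C \<inter> {0..<1})" and ne: "C \<noteq> {}"
    and per: "\<And>t. t + 1 \<in> C \<longleftrightarrow> t \<in> C"
  obtains m and \<tau> :: "nat \<Rightarrow> real" where "m > 0" "strict_mono \<tau>" "\<forall>i. \<tau> (i + m) = \<tau> i + 1"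
    "range \<tau> \<subseteq> C" "\<forall>t\<in>C. \<exists>i k. t = \<tau> (Suc i) + of_int k"
proof -
  have per': "t + of_int k \<in> C \<longleftrightarrow> t \<in> C" for t k
    using periodic_add_int[of "\<lambda>t. t \<in> C" t k] per by simp
  have frac: "frac t \<in> C \<inter> {0..<1}" if "t \<in> C" for t
    using that per'[of t "- \<lfloor>t\<rfloor>"] by (simp add: frac_def frac_lt_1 flip: frac_def)
  define ts where "ts = sorted_list_of_set (C \<inter> {0..<1})"
  define m where "m = length ts"
  define \<tau> where "\<tau> i = ts ! (i mod m) + real (i div m)" for i
  have set_ts: "set ts = C \<inter> {0..<1}" using fin by (simp add: ts_def)
  have m: "m > 0" using ne frac set_ts unfolding m_def by (metis ex_in_conv length_greater_0_conv set_empty)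
  have nth: "ts ! i \<in> C \<inter> {0..<1}" if "i < m" for i using that set_ts m_def nth_mem by blast
  have \<tau>_add: "\<tau> (i + m) = \<tau> i + 1" for i using m by (simp add: \<tau>_def)
  have "\<tau> i < \<tau> (Suc i)" for i
  proof (cases "Suc (i mod m) = m")
    case True
    then have "Suc i mod m = 0" "Suc i div m = Suc (i div m)"
      by (simp_all add: mod_Suc div_Suc)
    then show ?thesis using nth[of "i mod m"] nth[of 0] m by (simp add: \<tau>_def)
  next
    case False
    then have "Suc i mod m = Suc (i mod m)" "Suc i div m = i div m" "Suc (i mod m) < m"
      using mod_less_divisor[OF m, of i] by (simp_all add: mod_Suc div_Suc)
    moreover have "sorted_wrt (<) ts" by (simp add: ts_def)
    ultimately show ?thesis by (simp add: \<tau>_def sorted_wrt_nth_less m_def)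
  qed
  then have "strict_mono \<tau>" by (simp add: strict_mono_Suc_iff)
  moreover have "range \<tau> \<subseteq> C"
    using nth m per'[of _ "int k" for k] by (auto simp: \<tau>_def)
  moreover have "\<forall>t\<in>C. \<exists>i k. t = \<tau> (Suc i) + of_int k"
  proof
    fix t assume t: "t \<in> C"
    obtain j where j: "j < m" "ts ! j = frac t"
      using frac[OF t] set_ts by (metis in_set_conv_nth m_def)
    \<comment> \<open>One period is added to the index and subtracted again from the integer part,
      so that the index is a successor even for \<open>j = 0\<close>.\<close>
    have "t = \<tau> (Suc (j + m - 1)) + of_int (\<lfloor>t\<rfloor> - 1)"
      using j m \<tau>_add[of j] by (simp add: \<tau>_def frac_def)
    then show "\<exists>i k. t = \<tau> (Suc i) + of_int k" by blast
  qed
  ultimately show thesis using m \<tau>_add by (intro that[of m \<tau>]) simp_all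
qed

section \<open>Fronts without crossings\<close>

lemma smooth_imp_continuous_on: "smooth f \<Longrightarrow> continuous_on UNIV f"
  using ck.simps(1)[of f] by (simp only: smooth_def)

lemma smooth_imp_differentiable: "smooth f \<Longrightarrow> f differentiable (at x)"
  using ck.simps(2)[of 0 f] unfolding smooth_def by blast

lemma vector_derivative_shift_domain:
  fixes f :: "real \<Rightarrow> 'a::real_normed_vector"
  assumes "f differentiable (at (t + c))"
  shows "vector_derivative (\<lambda>s. f (s + c)) (at t) = vector_derivative f (at (t + c))"
proof -
  have "((\<lambda>s. s + c) has_vector_derivative 1) (at t)" by (auto intro!: derivative_eq_intros)
  from vector_diff_chain_at[OF this] assms
  show ?thesis by (intro vector_derivative_at) (auto simp: vector_derivative_works o_def)
qed

lemma periodic_add_1_cusp: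
  assumes "knot D"
  shows "cusp D (t + 1) \<longleftrightarrow> cusp D t"
proof -
  have "(\<lambda>s. D (s + 1)) = D" using assms by (simp add: knot_def)
  then have "vector_derivative D (at (t + 1)) = vector_derivative D (at t)"
    using vector_derivative_shift_domain[of D t 1] assms smooth_imp_differentiable[of D]
    by (simp add: knot_def)
  then show ?thesis by (simp add: cusp_def front_dx_def front_dz_def)
qed

text \<open>The \<open>x\<close>-coordinate is periodic, so its derivative vanishes somewhere by
  Rolle's theorem, and there \<open>dz = y dx\<close> makes the whole front velocity vanish.\<close>

lemma legendrian_knot_ex_cusp:
  assumes "legendrian_knot D"
  obtains t where "cusp D t"
proof -
  have D: "knot D" using assms by (simp add: legendrian_knot_def)
  have der: "((\<lambda>t. D t $ 1) has_real_derivative front_dx D t) (at t)" for t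
    unfolding front_dx_def has_real_derivative_iff_has_vector_derivative
    using D smooth_imp_differentiable[of D t]
    by (intro bounded_linear.has_vector_derivative[OF bounded_linear_vec_nth])
      (simp add: vector_derivative_works[symmetric] knot_def)
  have "D (0 + 1) = D 0" using D unfolding knot_def by blast
  then have "\<exists>z. 0 < z \<and> z < (1::real) \<and> (*) (front_dx D z) = (\<lambda>v. 0)"
    using der unfolding has_field_derivative_def
    by (intro Rolle_deriv[of 0 1 "\<lambda>t. D t $ 1"] continuous_at_imp_continuous_on)
      (auto intro: has_derivative_continuous)
  then obtain z where "(*) (front_dx D z) = (\<lambda>v. 0)" by blast
  then have "front_dx D z = 0" by (metis mult.right_neutral)
  then have "cusp D z"
    using assms by (auto simp: legendrian_knot_def cusp_def front_dx_def front_dz_def)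
  then show thesis by (rule that)
qed

lemma crossings_empty_imp:
  assumes "knot D" "crossings D = {}"
  shows "\<not> crossing D u v"
proof
  assume "crossing D u v"
  moreover have "D (frac t) = D t" for t
    using periodic_add_int[of D t "- \<lfloor>t\<rfloor>"] assms(1) by (simp add: knot_def frac_def)
  ultimately have "(frac u, frac v) \<in> crossings D"
    by (simp add: crossings_def crossing_def same_front_point_def frac_ge_0 frac_lt_1)
  then show False using assms(2) by simp
qed

text \<open>Without crossings the cusps are the only break points, so the strands are the arcs
  between consecutive cusps and the presentation is cyclic.\<close>

lemma card_LR_front:
  assumes D: "legendrian_knot D" and gen: "generic_front D" and cr: "crossings D = {}"
  shows "card (elems (LR_front n D)) = gcd (2 * n + 1) (card (strands D))"
proof -
  define C where "C = {t. cusp D t}"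
  have knot: "knot D" using D by (simp add: legendrian_knot_def)
  have nocr: "\<not> crossing D u v" for u v using crossings_empty_imp[OF knot cr] .
  have per: "t + 1 \<in> C \<longleftrightarrow> t \<in> C" for t using periodic_add_1_cusp[OF knot] by (simp add: C_def)
  have "C \<inter> {0..<1} = {t \<in> {0..<1}. cusp D t}" by (auto simp: C_def)
  then have fin: "finite (C \<inter> {0..<1})" using gen by (simp add: generic_front_def)
  obtain t where "cusp D t" by (rule legendrian_knot_ex_cusp[OF D])
  then have ne: "C \<noteq> {}" by (auto simp: C_def)
  obtain m \<tau> where \<tau>: "m > 0" "strict_mono \<tau>" "\<forall>i. \<tau> (i + m) = \<tau> i + 1"
    "range \<tau> \<subseteq> C" "\<forall>t\<in>C. \<exists>i k. t = \<tau> (Suc i) + of_int k"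
    by (rule obtain_periodic_enumeration[OF fin ne per])
  interpret subdivided_closed_curve D \<tau> m
    using knot \<tau>(1-3) by unfold_locales (auto simp: knot_def smooth_imp_continuous_on)
  have "break_points D = C" using nocr by (auto simp: break_points_def C_def)
  \<comment> \<open>The list \<open>\<tau>\<close> need not reach every cusp parameter, but it
    reaches each of them up to an integer.\<close>
  moreover have "D ` C = D ` range \<tau>"
  proof
    show "D ` C \<subseteq> D ` range \<tau>"
    proof (rule image_subsetI)
      fix t assume "t \<in> C"
      then obtain i k where "t = \<tau> (Suc i) + of_int k" using \<tau>(5) by blast
      then show "D t \<in> D ` range \<tau>" by (simp add: f_add_int)
    qed
  qed (use \<tau>(4) in blast)
  ultimately have strands: "strands D = range arc" by (simp add: strands_def components_eq)
  have inc: "incoming D (\<tau> (Suc i) + of_int k) a \<longleftrightarrow> a = arc i" for i k a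
    unfolding incoming_def strands
    by (rule eventually_in_arc_iff[OF _ eventually_at_left_in_arc]) simp
  have out: "outgoing D (\<tau> i + of_int k) a \<longleftrightarrow> a = arc i" for i k a
    unfolding outgoing_def strands
    by (rule eventually_in_arc_iff[OF _ eventually_at_right_in_arc]) simp
  \<comment> \<open>The parameter \<open>t\<close> ranges over the whole line and meets each cusp
    once per period; all these parameters give the same pair of strands.\<close>
  have cusp_iff: "(\<exists>t. cusp D t \<and> incoming D t a \<and> outgoing D t b) \<longleftrightarrow> (\<exists>i. a = arc i \<and> b = arc (Suc i))"
    for a b
  proof
    assume "\<exists>t. cusp D t \<and> incoming D t a \<and> outgoing D t b"
    then obtain t where t: "t \<in> C" "incoming D t a" "outgoing D t b" by (auto simp: C_def)
    then obtain i k where "t = \<tau> (Suc i) + of_int k" using \<tau>(5) by blast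
    then have "a = arc i \<and> b = arc (Suc i)" using t inc out by simp
    then show "\<exists>i. a = arc i \<and> b = arc (Suc i)" by blast
  next
    assume "\<exists>i. a = arc i \<and> b = arc (Suc i)"
    then obtain i where "a = arc i" "b = arc (Suc i)" by blast
    then have "cusp D (\<tau> (Suc i)) \<and> incoming D (\<tau> (Suc i)) a \<and> outgoing D (\<tau> (Suc i)) b"
      using \<tau>(4) inc[of i 0] out[of "Suc i" 0] by (auto simp: C_def)
    then show "\<exists>t. cusp D t \<and> incoming D t a \<and> outgoing D t b" by blast
  qed
  have "front_relations n D = {(Gen b, rpow Star (Gen a) (n + 1)) | a b.
      \<exists>t. cusp D t \<and> incoming D t a \<and> outgoing D t b}"
    using nocr by (simp add: front_relations_def)
  also have "\<dots> = {(Gen b, rpow Star (Gen a) (n + 1)) | a b. \<exists>i. a = arc i \<and> b = arc (Suc i)}"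
    by (simp only: cusp_iff)
  also have "\<dots> = {(Gen (arc (Suc i)), rpow Star (Gen (arc i)) (n + 1)) | i. True}"
    by blast
  finally have rels: "front_relations n D =
    {(Gen (arc (Suc i)), rpow Star (Gen (arc i)) (n + 1)) | i. True}" .
  show ?thesis
    unfolding LR_front_def rels strands card_arcs
    using m arc_eq_iff by (rule card_cyclically_presented_rack)
qed

section \<open>From fronts to Legendrian knots\<close>

lemma front_projection_legendrian_knot:
  assumes "front_projection L D"
  shows "legendrian_knot D"
proof -
  obtain H where "\<forall>\<tau>\<in>{0..1}. legendrian_knot (\<lambda>t. H (\<tau>, t))" "\<forall>t. H (1::real, t) = D t"
    using assms by (auto simp: front_projection_def isotopic_through_def)
  then show ?thesis by (auto dest: bspec[of _ _ 1])
qed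

text \<open>\<open>front_of\<close> minimises the number of crossings, so one crossingless
  projection forces it to be crossingless too.\<close>

lemma minimal_diagram_front_of:
  assumes "minimal_diagram L D"
  shows "minimal_diagram L (front_of L)"
proof -
  have D: "front_projection L D" "card (crossings D) = 0"
    using assms by (simp_all add: minimal_diagram_def)
  have fp: "front_projection L (front_of L)"
    unfolding front_of_def by (rule arg_min_natI[of "front_projection L" D, OF D(1)])
  moreover have "card (crossings (front_of L)) \<le> card (crossings D)"
    unfolding front_of_def by (rule arg_min_nat_le[of "front_projection L" D, OF D(1)])
  \<comment> \<open>An infinite set also has \<open>card\<close> 0, so finiteness is needed to
    conclude that there are no crossings.\<close>
  moreover have "finite (crossings (front_of L))"
    using fp by (simp add: front_projection_def generic_front_def)
  ultimately show ?thesis using D(2) by (simp add: minimal_diagram_def)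
qed

lemma card_LR:
  assumes "has_s_min L s"
  shows "card (elems (LR n L)) = gcd (2 * n + 1) s"
proof -
  have m: "minimal_diagram L (front_of L)"
    using assms minimal_diagram_front_of by (auto simp: has_s_min_def)
  then have s: "card (strands (front_of L)) = s"
    using assms by (simp add: has_s_min_def)
  have "legendrian_knot (front_of L)" "generic_front (front_of L)" "crossings (front_of L) = {}"
    using m front_projection_legendrian_knot by (auto simp: minimal_diagram_def front_projection_def)
  from card_LR_front[OF this] s
  show ?thesis by (simp_all add: LR_def)
qed

theorem theorem2:
  fixes L1 L2 :: "real \<Rightarrow> real^3" and s1 s2 :: nat
  assumes "legendrian_knot L1" and "topologically_trivial L1"
    and "legendrian_knot L2" and "topologically_trivial L2"
    and "has_s_min L1 s1" and "has_s_min L2 s2"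
    and "\<exists>(p::nat) k. prime p \<and> odd p \<and> k > 0 \<and> p ^ k dvd s1 \<and> \<not> p ^ k dvd s2"
  shows "\<exists>n. \<not> rack_iso (LR n L1) (LR n L2)"
proof -
  obtain p k :: nat where p: "odd p" "p ^ k dvd s1" "\<not> p ^ k dvd s2" using assms(7) by blast
  then have "odd (p ^ k)" by simp
  \<comment> \<open>This \<open>n\<close> makes \<open>p ^ k\<close> the modulus: the gcd with
    \<open>s1\<close> is all of \<open>p ^ k\<close>, the one with \<open>s2\<close> is not.\<close>
  then obtain n where n: "p ^ k = 2 * n + 1" by (rule oddE)
  have "gcd (2 * n + 1) s1 = p ^ k" using p(2) unfolding n by (simp add: gcd_nat.absorb1)
  moreover have "gcd (2 * n + 1) s2 \<noteq> p ^ k" using p(3) unfolding n by (metis gcd_dvd2)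
  ultimately have "card (elems (LR n L1)) \<noteq> card (elems (LR n L2))"
    using card_LR[OF assms(5)] card_LR[OF assms(6)] by simp
  then show ?thesis unfolding rack_iso_def using bij_betw_same_card by blast
qed

end
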